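(* Let $X$ be a (connected) finite graph. The following are equivalent: (1) $X$ has no cut points; (2) $X$ is $3$-sac; (3) any three distinct points of $X$ lie either on a circle contained in $X$ or on a theta curve contained in $X$.
   Context: A finite graph is a nondegenerate continuum (compact connected metric space with more than one point) which is the union of finitely many arcs, any two of which are disjoint or meet only in one or both of their end points. A cut point of a connected space $X$ is a point $x$ such that $X\setminus\{x\}$ is disconnected. A circle is a simple closed curve (a homeomorphic copy of the unit circle); a theta curve is a space that is the union of three arcs with the same two end points and otherwise pairwise disjoint. An arc in a space $X$ is a homeomorphic embedding $\alpha:[0,1]\to X$ (or its image). A topological space $X$ is $n$-strongly arc connected ($n$-sac) if for every $n$ distinct points $x_1,\dots,x_n$ of $X$ there are an arc $\alpha:[0,1]\to X$ and $t_1<t_2<\dots<t_n$ in $[0,1]$ such that $\alpha(t_i)=x_i$ for $i=1,\dots,n$. *)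

theory Defs
  imports "HOL-Analysis.Analysis"
begin

text \<open>
  Spaces are carried by subsets of a type, with the subspace topology. In a Hausdorff space an
  injective continuous image of \<open>{0..1}\<close> is a homeomorphic copy of it, so the library's
  \<^const>\<open>arc\<close> is a homeomorphic embedding of the unit interval.
\<close>

definition nondegenerate_continuum :: "'a::metric_space set \<Rightarrow> bool" where
  "nondegenerate_continuum X \<longleftrightarrow>
     compact X \<and> connected X \<and> (\<exists>x\<in>X. \<exists>y\<in>X. x \<noteq> y)"

text \<open>
  The arcs are given by parametrisations. Distinct members of \<open>G\<close> automatically have distinct
  images, since arcs meeting only in end points cannot coincide.
\<close>

definition finite_graph :: "'a::metric_space set \<Rightarrow> bool" where
  "finite_graph X \<longleftrightarrow>
     nondegenerate_continuum X \<and>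
     (\<exists>G :: (real \<Rightarrow> 'a) set.
        finite G \<and> (\<forall>g\<in>G. arc g) \<and> X = (\<Union>g\<in>G. path_image g) \<and>
        (\<forall>g\<in>G. \<forall>h\<in>G. g \<noteq> h \<longrightarrow>
           path_image g \<inter> path_image h
             \<subseteq> {pathstart g, pathfinish g} \<inter> {pathstart h, pathfinish h}))"

definition cut_point :: "'a::topological_space set \<Rightarrow> 'a \<Rightarrow> bool" where
  "cut_point X x \<longleftrightarrow> x \<in> X \<and> \<not> connected (X - {x})"

definition circle :: "'a::topological_space set \<Rightarrow> bool" where
  "circle C \<longleftrightarrow> C homeomorphic sphere (0::complex) 1"

definition theta_curve :: "'a::t2_space set \<Rightarrow> bool" where
  "theta_curve T \<longleftrightarrow>
     (\<exists>a b p q r.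
        (\<forall>g\<in>{p, q, r}. arc g \<and> pathstart g = a \<and> pathfinish g = b) \<and>
        path_image p \<inter> path_image q = {a, b} \<and>
        path_image p \<inter> path_image r = {a, b} \<and>
        path_image q \<inter> path_image r = {a, b} \<and>
        T = path_image p \<union> path_image q \<union> path_image r)"

definition strongly_arc_connected :: "nat \<Rightarrow> 'a::t2_space set \<Rightarrow> bool" where
  "strongly_arc_connected n X \<longleftrightarrow>
     (\<forall>x :: nat \<Rightarrow> 'a. inj_on x {1..n} \<and> x ` {1..n} \<subseteq> X \<longrightarrow>
        (\<exists>\<alpha> t. arc \<alpha> \<and> path_image \<alpha> \<subseteq> X \<and>
           t ` {1..n} \<subseteq> {0..1} \<and> strict_mono_on {1..n} t \<and>
           (\<forall>i\<in>{1..n}. \<alpha> (t i) = x i)))"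

end

theory Submission
  imports Defs
begin

text \<open>
  The implications towards ``no cut points'' are soft. A circle or theta curve stays connected when a
  point is removed, and if an arc visits \<open>x\<close>, \<open>y\<close>, \<open>z\<close> in this order then its piece from \<open>y\<close> to \<open>z\<close>
  misses \<open>x\<close>. Either way any two points other than \<open>x\<close> are joined by a connected set avoiding \<open>x\<close>
  (\<open>not_cut_point_if_joined\<close>).

  Conversely let \<open>X\<close> be without cut points. The argument is the ear decomposition of a 2-connected
  graph, carried out on point sets so that no subdivision of the graph is ever needed. An ear of a
  circle \<open>C\<close> is an arc that meets \<open>C\<close> exactly in its two ends; a circle together with an ear is a
  theta curve. Two facts carry the proof:

  \<^item> Every edge lies on a circle (\<open>edge_on_circle\<close>): after removal of the midpoint of the edge its two
    ends can still be joined by an arc, and such an arc cannot enter the open edge.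

  \<^item> Every point off a circle \<open>C\<close> lies on an ear of \<open>C\<close> (\<open>ear_through_point\<close>): the set of points that lie
    on \<open>C\<close> or on an ear absorbs each edge that it meets, so it is \<open>X\<close> by connectedness.

  Any \<open>x \<noteq> y\<close> therefore lie on a circle: take a circle through an edge containing \<open>x\<close>, and if \<open>y\<close> is
  not on it replace a part of the circle that misses \<open>x\<close> by an ear through \<open>y\<close>. A third point \<open>z\<close> lies on this
  circle or on an ear of it, which gives the circle or theta curve. For the arc from \<open>x\<close> through \<open>y\<close>
  to \<open>z\<close>, use the circle to pass from \<open>x\<close> to \<open>y\<close>, and then the rest of the circle and possibly a leg
  of the ear to reach \<open>z\<close> (\<open>arc_with_middle_point\<close>).
\<close>

section \<open>Arcs as sets\<close>

text \<open>
  Set identities between arcs with prescribed intersections, restated as first-order facts about points.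
\<close>

lemmas pointwise = set_eq_iff Un_iff Int_iff insert_iff empty_iff

text \<open>
  Only the images of arcs and their ends matter below, so parametrisations are hidden: splitting, joining
  and reversing then need no reparametrisation.
\<close>

definition arc_between :: "'a::t2_space set \<Rightarrow> 'a \<Rightarrow> 'a \<Rightarrow> bool" where
  "arc_between A a b \<longleftrightarrow> (\<exists>g. arc g \<and> path_image g = A \<and> pathstart g = a \<and> pathfinish g = b)"

lemma arc_between_ends:
  assumes "arc_between A a b"
  shows "a \<in> A" "b \<in> A" "a \<noteq> b"
  using assms arc_distinct_ends unfolding arc_between_def by force+

lemma arc_between_sym: "arc_between A a b \<Longrightarrow> arc_between A b a"
  unfolding arc_between_def
  by (metis arc_reversepath path_image_reversepath pathfinish_reversepath pathstart_reversepath)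

lemma arc_between_closed: "arc_between A a b \<Longrightarrow> closed A"
  unfolding arc_between_def using compact_arc_image compact_imp_closed by blast

lemma arc_between_connected: "arc_between A a b \<Longrightarrow> connected A"
  unfolding arc_between_def using connected_arc_image by blast

lemma arc_between_connected_minus_end:
  assumes "arc_between A a b"
  shows "connected (A - {a})"
proof -
  obtain g where g: "arc g" "path_image g = A" "pathstart g = a"
    using assms unfolding arc_between_def by blast
  have inj: "inj_on g {0..1}" and cont: "continuous_on {0..1} g"
    using g(1) by (auto simp: arc_def path_def)
  have "A - {a} = g ` ({0..1} - {0})"
    using g inj by (auto simp: path_image_def pathstart_def dest: inj_onD)
  also have "{0..1} - {0} = {0<..(1::real)}" by auto
  finally have eq: "A - {a} = g ` {0<..1}" .
  have "continuous_on {0<..1} g"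
    using cont by (rule continuous_on_subset) auto
  then show ?thesis
    unfolding eq by (intro connected_continuous_image) auto
qed

lemma arc_between_join:
  assumes "arc_between A a b" "arc_between B b c" "A \<inter> B = {b}"
  shows "arc_between (A \<union> B) a c"
proof -
  obtain g h where g: "arc g" "path_image g = A" "pathstart g = a" "pathfinish g = b"
    and h: "arc h" "path_image h = B" "pathstart h = b" "pathfinish h = c"
    using assms unfolding arc_between_def by blast
  have "arc (g +++ h)" using g h assms(3) by (intro arc_join) auto
  moreover have "path_image (g +++ h) = A \<union> B"
    using g h by (simp add: path_image_join)
  ultimately show ?thesis
    unfolding arc_between_def using g h by (metis pathfinish_join pathstart_join)
qed

lemma arc_between_restrict:
  assumes g: "arc g" and uv: "0 \<le> u" "u < v" "v \<le> 1"
  shows "arc_between (g ` {u..v}) (g u) (g v)"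
proof -
  define f where "f = (\<lambda>x. u + x * (v - u))"
  have fim: "f ` {0..1} = {u..v}"
  proof
    have "u + x * (v - u) \<le> v" if "x \<in> {0..1}" for x
    proof -
      have "x * (v - u) \<le> v - u" using that uv by (intro mult_left_le_one_le) auto
      then show ?thesis by simp
    qed
    then show "f ` {0..1} \<subseteq> {u..v}" using uv by (auto simp: f_def)
    show "{u..v} \<subseteq> f ` {0..1}"
    proof
      fix y assume "y \<in> {u..v}"
      then show "y \<in> f ` {0..1}"
        using uv by (intro image_eqI[of _ _ "(y - u) / (v - u)"]) (auto simp: f_def)
    qed
  qed
  have sub: "{u..v} \<subseteq> {0..1}" using uv by auto
  have "inj_on f {0..1}" using uv by (auto simp: f_def inj_on_def)
  moreover have "inj_on g (f ` {0..1})"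
    unfolding fim using g by (intro inj_on_subset[OF _ sub]) (simp add: arc_def)
  ultimately have "inj_on (g \<circ> f) {0..1}" by (rule comp_inj_on)
  moreover have "continuous_on {0..1} (g \<circ> f)"
  proof (rule continuous_on_compose)
    show "continuous_on {0..1} f" unfolding f_def by (intro continuous_intros)
    show "continuous_on (f ` {0..1}) g"
      unfolding fim using g sub by (auto simp: arc_def path_def intro: continuous_on_subset)
  qed
  ultimately have "arc (g \<circ> f)" by (simp add: arc_def path_def)
  moreover have "path_image (g \<circ> f) = g ` {u..v}"
    by (metis fim image_comp path_image_def)
  ultimately show ?thesis
    unfolding arc_between_def by (intro exI[of _ "g \<circ> f"]) (auto simp: pathstart_def pathfinish_def f_def)
qed

lemma arc_between_split:
  assumes "arc_between A a b" "p \<in> A" "p \<noteq> a" "p \<noteq> b"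
  obtains A1 A2 where "arc_between A1 a p" "arc_between A2 p b" "A = A1 \<union> A2" "A1 \<inter> A2 = {p}"
proof -
  obtain g where g: "arc g" "path_image g = A" "pathstart g = a" "pathfinish g = b"
    using assms unfolding arc_between_def by blast
  then obtain u where u: "u \<in> {0..1}" "g u = p" using assms(2) by (auto simp: path_image_def)
  have u0: "0 < u" "u < 1"
    using u g assms(3,4) by (auto simp: pathstart_def pathfinish_def less_le)
  have ends: "g 0 = a" "g 1 = b" using g by (auto simp: pathstart_def pathfinish_def)
  have inj: "inj_on g {0..1}" using g by (simp add: arc_def)
  have "g ` {0..u} \<inter> g ` {u..1} = g ` ({0..u} \<inter> {u..1})"
    using u0 by (intro inj_on_image_Int[OF inj, symmetric]) auto
  also have "{0..u} \<inter> {u..1} = {u}" using u0 by auto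
  finally have int: "g ` {0..u} \<inter> g ` {u..1} = {p}" using u by simp
  have "{0..1} = {0..u} \<union> {u..1}" using u0 by auto
  then have "A = g ` {0..u} \<union> g ` {u..1}" using g(2) by (metis image_Un path_image_def)
  with int show ?thesis
    using that arc_between_restrict[OF g(1), of 0 u] arc_between_restrict[OF g(1), of u 1] u0 u ends
    by simp
qed

text \<open>
  The parameters at which the arc is in \<open>K\<close> form a compact set, so there is a first one.
\<close>

lemma first_hit:
  assumes "arc_between A a b" "closed K" "a \<notin> K" "A \<inter> K \<noteq> {}"
  obtains B p where "B \<subseteq> A" "arc_between B a p" "B \<inter> K = {p}"
proof -
  obtain g where g: "arc g" "path_image g = A" "pathstart g = a"
    using assms unfolding arc_between_def by blast
  define S where "S = {0..1} \<inter> g -` K"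
  have "closed S" unfolding S_def
    using g assms(2) by (intro continuous_closed_preimage) (auto simp: arc_def path_def)
  moreover have ne: "S \<noteq> {}" using g assms(4) by (auto simp: S_def path_image_def)
  moreover have bdd: "bdd_below S" by (auto simp: S_def bdd_below_def)
  ultimately have uS: "Inf S \<in> S" by (intro closed_contains_Inf)
  define u where "u = Inf S"
  have u: "0 \<le> u" "u \<le> 1" "g u \<in> K" using uS by (auto simp: S_def u_def)
  have "u \<noteq> 0" using u g assms(3) by (auto simp: pathstart_def)
  with u have u0: "0 < u" by simp
  have least: "w = u" if "w \<in> {0..u}" "g w \<in> K" for w
  proof -
    have "w \<in> S" using that u by (auto simp: S_def)
    then have "u \<le> w" unfolding u_def using bdd by (intro cInf_lower)
    then show ?thesis using that by simp
  qed
  show ?thesis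
  proof
    show "g ` {0..u} \<subseteq> A" using g(2) u by (auto simp: path_image_def)
    show "arc_between (g ` {0..u}) a (g u)"
      using arc_between_restrict[OF g(1) _ u0] u g(3) by (simp add: pathstart_def)
    show "g ` {0..u} \<inter> K = {g u}" using least u by force
  qed
qed

section \<open>Arcwise connectedness\<close>

text \<open>
  Both \<open>S\<close> and its complement in \<open>U\<close> are unions of pieces, hence closed in \<open>U\<close>.
\<close>

lemma connected_absorbs_finite_closed_cover:
  assumes "connected U" "finite \<P>" "\<And>P. P \<in> \<P> \<Longrightarrow> closedin (top_of_set U) P" "U = \<Union>\<P>"
    and "S \<subseteq> U" "S \<noteq> {}" and abs: "\<And>P. P \<in> \<P> \<Longrightarrow> P \<inter> S \<noteq> {} \<Longrightarrow> P \<subseteq> S"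
  shows "S = U"
proof -
  let ?I = "{P \<in> \<P>. P \<inter> S \<noteq> {}}" and ?O = "{P \<in> \<P>. P \<inter> S = {}}"
  have S: "S = \<Union>?I" using assms(4,5) abs by blast
  have O: "U - S = \<Union>?O" using assms(4) abs by blast
  have "closedin (top_of_set U) S" 
    using closedin_Union[of ?I] assms(2,3) by (subst S) auto
  moreover have "closedin (top_of_set U) (U - S)"
    using closedin_Union[of ?O] assms(2,3) by (subst O) auto
  ultimately have "U - S = {}"
    using assms(1,5,6) unfolding connected_closedin_eq by blast
  then show ?thesis using assms(5) by blast
qed

definition arc_joined :: "'a::t2_space set \<Rightarrow> 'a \<Rightarrow> 'a \<Rightarrow> bool" where
  "arc_joined U p q \<longleftrightarrow> p = q \<or> (\<exists>Q\<subseteq>U. arc_between Q p q)"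

lemma arc_joined_sym: "arc_joined U p q \<Longrightarrow> arc_joined U q p"
  unfolding arc_joined_def using arc_between_sym by blast

text \<open>
  Two arcs with a common end may cross many times. Following the second arc backwards from \<open>r\<close> up to its
  first point \<open>w\<close> on the first one, and then the first arc, yields an arc.
\<close>

lemma arc_joined_trans:
  assumes "arc_joined U p q" "arc_joined U q r"
  shows "arc_joined U p r"
proof (cases "p = q \<or> q = r \<or> p = r")
  case True
  then show ?thesis using assms by (auto simp: arc_joined_def)
next
  case False
  then obtain A B where A: "A \<subseteq> U" "arc_between A p q" and B: "B \<subseteq> U" "arc_between B q r"
    using assms by (auto simp: arc_joined_def)
  show ?thesis
  proof (cases "r \<in> A")
    case True
    with A False obtain A1 where "A1 \<subseteq> A" "arc_between A1 p r"
      by (metis Un_upper1 arc_between_split)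
    then show ?thesis using A by (auto simp: arc_joined_def)
  next
    case rA: False
    have "B \<inter> A \<noteq> {}" using arc_between_ends[OF A(2)] arc_between_ends[OF B(2)] by blast
    then obtain B1 w where B1: "B1 \<subseteq> B" "arc_between B1 r w" "B1 \<inter> A = {w}"
      using first_hit[OF arc_between_sym[OF B(2)] arc_between_closed[OF A(2)] rA] by metis
    show ?thesis
    proof (cases "w = p")
      case True
      then show ?thesis using B1 B arc_between_sym[OF B1(2)] by (auto simp: arc_joined_def)
    next
      case wp: False
      obtain A1 where A1: "A1 \<subseteq> A" "arc_between A1 p w"
      proof (cases "w = q")
        case True
        then show ?thesis using that A by blast
      next
        case False
        then show ?thesis using that wp A B1 by (metis Int_iff Un_upper1 arc_between_split singletonI)
      qed
      have "A1 \<inter> B1 = {w}" using A1 B1 arc_between_ends[OF A1(2)] by blast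
      then have "arc_between (A1 \<union> B1) p r"
        using arc_between_join A1(2) arc_between_sym[OF B1(2)] by blast
      moreover have "A1 \<union> B1 \<subseteq> U" using A1(1) B1(1) A(1) B(1) by blast
      ultimately show ?thesis by (auto simp: arc_joined_def)
    qed
  qed
qed

lemma arc_joined_subarc:
  assumes "arc g" "is_interval I" "I \<subseteq> {0..1}" "p \<in> g ` I" "q \<in> g ` I" "g ` I \<subseteq> U"
  shows "arc_joined U p q"
proof -
  have *: "arc_joined U (g u) (g v)" if "u \<in> I" "v \<in> I" "u < v" for u v
  proof -
    have "{u..v} \<subseteq> I"
      using that assms(2) by (meson atLeastAtMost_iff mem_is_interval_1_I subsetI)
    then have "g ` {u..v} \<subseteq> U" using assms(6) by blast
    moreover have "arc_between (g ` {u..v}) (g u) (g v)"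
      using assms(1,3) that by (intro arc_between_restrict) auto
    ultimately show ?thesis by (auto simp: arc_joined_def)
  qed
  obtain u v where uv: "u \<in> I" "p = g u" "v \<in> I" "q = g v" using assms(4,5) by blast
  show ?thesis
  proof (cases u v rule: linorder_cases)
    case less
    then show ?thesis using * uv by blast
  next
    case equal
    then show ?thesis using uv by (simp add: arc_joined_def)
  next
    case greater
    then have "arc_joined U q p" using * uv by blast
    then show ?thesis using arc_joined_sym by blast
  qed
qed

text \<open>
  Deleting \<open>s\<close> leaves the whole arc or two half-open arcs; the second kind of piece is closed only
  relative to what is left.
\<close>

lemma arc_minus_point_pieces:
  fixes s :: "'a::t2_space"
  assumes "arc g"
  obtains \<I> where "finite \<I>" "path_image g - {s} = (\<Union>I\<in>\<I>. g ` I)"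
    "\<And>I. I \<in> \<I> \<Longrightarrow> is_interval I \<and> I \<subseteq> {0..1} \<and> closedin (top_of_set (path_image g - {s})) (g ` I)"
proof (cases "s \<in> path_image g")
  case False
  then have eq: "path_image g - {s} = g ` {0..1}" by (auto simp: path_image_def)
  show ?thesis by (rule that[of "{{0..1}}"]) (simp_all add: eq is_interval_cc)
next
  case True
  then obtain c where c: "c \<in> {0..1}" "g c = s" by (auto simp: path_image_def)
  have inj: "inj_on g {0..1}" and cont: "continuous_on {0..1} g"
    using assms by (auto simp: arc_def path_def)
  have im: "g ` {0..1} - {s} = g ` ({0..1} - {c})"
    using c inj by (auto dest: inj_onD)
  have cl: "closed (g ` {u..v})" if "{u..v} \<subseteq> {0..1}" for u v
    using that cont by (meson compact_Icc compact_continuous_image compact_imp_closed continuous_on_subset)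
  have e1: "g ` {0..<c} = (g ` {0..1} - {s}) \<inter> g ` {0..c}"
    and e2: "g ` {c<..1} = (g ` {0..1} - {s}) \<inter> g ` {c..1}"
    unfolding im using c inj by (auto simp: less_le inj_on_eq_iff)
  show ?thesis
  proof (rule that[of "{{0..<c}, {c<..1}}"])
    show "path_image g - {s} = (\<Union>I\<in>{{0..<c}, {c<..1}}. g ` I)"
    proof -
      have "{0..1} - {c} = {0..<c} \<union> {c<..1}" using c by auto
      then show ?thesis by (simp add: path_image_def im image_Un)
    qed
    show "is_interval I \<and> I \<subseteq> {0..1} \<and> closedin (top_of_set (path_image g - {s})) (g ` I)"
      if "I \<in> {{0..<c}, {c<..1}}" for I
    proof -
      have "closedin (top_of_set (path_image g - {s})) (g ` {0..<c})"
        "closedin (top_of_set (path_image g - {s})) (g ` {c<..1})"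
        unfolding path_image_def e1 e2 using c by (auto intro!: closedin_closed_Int cl)
      then show ?thesis using that c by (auto simp: is_interval_1)
    qed
  qed simp
qed

text \<open>
  The points that can be reached from \<open>p\<close> by an arc absorb each of the finitely many relatively closed
  pieces of the punctured arcs that they meet, so connectedness gives arcwise connectedness without any
  appeal to local properties of \<open>X\<close>.
\<close>

lemma union_of_arcs_minus_point_arc_joined:
  fixes X :: "'a::t2_space set"
  assumes "finite G" "\<And>g. g \<in> G \<Longrightarrow> arc g" "X = (\<Union>g\<in>G. path_image g)"
    and con: "connected (X - {s})" and p: "p \<in> X - {s}" and q: "q \<in> X - {s}"
  shows "arc_joined (X - {s}) p q"
proof -
  let ?U = "X - {s}"
  define Q where "Q g \<I> \<longleftrightarrow> finite \<I> \<and> path_image g - {s} = (\<Union>I\<in>\<I>. g ` I) \<and>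
    (\<forall>I\<in>\<I>. is_interval I \<and> I \<subseteq> {0..1} \<and> closedin (top_of_set (path_image g - {s})) (g ` I))"
    for g :: "real \<Rightarrow> 'a" and \<I>
  have "\<exists>\<I>. Q g \<I>" if "g \<in> G" for g
    using arc_minus_point_pieces[OF assms(2)[OF that], of s] unfolding Q_def by metis
  then obtain J where J: "\<And>g. g \<in> G \<Longrightarrow> Q g (J g)" by metis
  define \<P> where "\<P> = (\<Union>g\<in>G. (\<lambda>I. g ` I) ` J g)"
  have "{q. q \<in> ?U \<and> arc_joined ?U p q} = ?U"
  proof (rule connected_absorbs_finite_closed_cover[OF con])
    show "finite \<P>" using assms(1) J by (auto simp: \<P>_def Q_def)
    show "closedin (top_of_set ?U) P" if P: "P \<in> \<P>" for P
    proof -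
      obtain g I where g: "g \<in> G" "I \<in> J g" "P = g ` I" using P by (auto simp: \<P>_def)
      have "closed (path_image g)" using assms(2) g(1) compact_arc_image compact_imp_closed by blast
      then have "closedin (top_of_set ?U) (?U \<inter> path_image g)" by (rule closedin_closed_Int)
      moreover have "?U \<inter> path_image g = path_image g - {s}" using assms(3) g(1) by blast
      moreover have "closedin (top_of_set (path_image g - {s})) P"
        using J[OF g(1)] g by (auto simp: Q_def)
      ultimately show ?thesis using closedin_trans by metis
    qed
    have "\<Union>\<P> = (\<Union>g\<in>G. path_image g - {s})"
      using J by (auto simp: \<P>_def Q_def)
    then show "?U = \<Union>\<P>" using assms(3) by blast
    show "{q \<in> ?U. arc_joined ?U p q} \<noteq> {}" using p by (auto simp: arc_joined_def)
    show "P \<subseteq> {q \<in> ?U. arc_joined ?U p q}"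
      if P: "P \<in> \<P>" and ne: "P \<inter> {q \<in> ?U. arc_joined ?U p q} \<noteq> {}" for P
    proof
      fix r assume r: "r \<in> P"
      obtain g I where g: "g \<in> G" "I \<in> J g" "P = g ` I" using P by (auto simp: \<P>_def)
      obtain r' where r': "r' \<in> P" "arc_joined ?U p r'" using ne by blast
      have PU: "P \<subseteq> ?U" using \<open>?U = \<Union>\<P>\<close> P by blast
      have "arc_joined ?U r' r"
        using J[OF g(1)] g r r' PU assms(2) by (intro arc_joined_subarc[of g I]) (auto simp: Q_def)
      then show "r \<in> {q \<in> ?U. arc_joined ?U p q}" using arc_joined_trans r' r PU by blast
    qed
  qed blast
  then show ?thesis using q by blast
qed

section \<open>Free arcs\<close>

text \<open>
  The interior of \<open>A\<close> is attached to the rest of \<open>X\<close> only through \<open>a\<close> and \<open>b\<close>. Edges of a graph are free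
  arcs, and so are their subarcs.
\<close>

definition free_arc :: "'a::t2_space set \<Rightarrow> 'a set \<Rightarrow> 'a \<Rightarrow> 'a \<Rightarrow> bool" where
  "free_arc X A a b \<longleftrightarrow> arc_between A a b \<and> (\<exists>R. closed R \<and> X = A \<union> R \<and> A \<inter> R \<subseteq> {a, b})"

lemma free_arc_sym: "free_arc X A a b \<Longrightarrow> free_arc X A b a"
  unfolding free_arc_def using arc_between_sym by (metis insert_commute)

text \<open>
  The arc \<open>Q\<close> starts at one end of the free arc and ends outside it while avoiding the other end. Were it
  to enter \<open>A\<close> after its start, then \<open>A\<close> and the closed rest of \<open>X\<close> would separate the connected set
  \<open>Q - {a}\<close>.
\<close>

lemma free_arc_escape:
  assumes "free_arc X A a b" "arc_between Q a t" "Q \<subseteq> X - {b}" "t \<notin> A"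
  shows "Q \<inter> A = {a}"
proof -
  obtain R where R: "closed R" "X = A \<union> R" "A \<inter> R \<subseteq> {a, b}" and A: "arc_between A a b"
    using assms(1) unfolding free_arc_def by blast
  have "connected (Q - {a})" using assms(2) by (rule arc_between_connected_minus_end)
  moreover have "closed A" using A by (rule arc_between_closed)
  moreover have "A \<inter> R \<inter> (Q - {a}) = {}" using R assms(3) by blast
  moreover have "Q - {a} \<subseteq> A \<union> R" using R assms(3) by blast
  ultimately have "A \<inter> (Q - {a}) = {} \<or> R \<inter> (Q - {a}) = {}"
    using R(1) by (intro connected_closedD) auto
  moreover have "t \<in> R \<inter> (Q - {a})"
    using arc_between_ends[OF assms(2)] assms(3,4) R by blast
  ultimately show ?thesis using arc_between_ends[OF assms(2)] arc_between_ends[OF A] by blast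
qed

section \<open>Circles, theta curves and ears\<close>

text \<open>
  A circle with two marked points that cut it into two arcs. The marked points can be moved to any two
  points of the circle (\<open>double_arc_any_ends\<close>).
\<close>

definition double_arc :: "'a::t2_space set \<Rightarrow> 'a \<Rightarrow> 'a \<Rightarrow> bool" where
  "double_arc C a b \<longleftrightarrow>
     (\<exists>A B. arc_between A a b \<and> arc_between B a b \<and> A \<inter> B = {a, b} \<and> C = A \<union> B)"

lemma double_arcI:
  "\<lbrakk>arc_between A a b; arc_between B a b; A \<inter> B = {a, b}\<rbrakk> \<Longrightarrow> double_arc (A \<union> B) a b"
  unfolding double_arc_def by blast

lemma double_arc_sym: "double_arc C a b \<Longrightarrow> double_arc C b a"
  unfolding double_arc_def using arc_between_sym by (metis insert_commute)

lemma double_arc_closed: "double_arc C a b \<Longrightarrow> closed C"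
  unfolding double_arc_def using arc_between_closed by blast

lemma double_arc_ends: "double_arc C a b \<Longrightarrow> a \<in> C \<and> b \<in> C \<and> a \<noteq> b"
  unfolding double_arc_def using arc_between_ends by blast

lemma double_arc_imp_circle:
  assumes "double_arc C a b"
  shows "circle C"
proof -
  obtain A B where "arc_between A a b" "arc_between B b a" "A \<inter> B = {a, b}" and C: "C = A \<union> B"
    using assms arc_between_sym unfolding double_arc_def by blast
  then obtain g h where g: "arc g" "path_image g = A" "pathstart g = a" "pathfinish g = b"
    and h: "arc h" "path_image h = B" "pathstart h = b" "pathfinish h = a"
    and int: "A \<inter> B = {a, b}"
    unfolding arc_between_def by blast
  have "simple_path (g +++ h)" using g h int by (intro simple_path_join_loop) auto
  moreover have "path_image (g +++ h) = C" using g h C by (simp add: path_image_join)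
  ultimately show ?thesis
    using homeomorphic_simple_path_image_circle[of "g +++ h" 1 0] g h by (simp add: circle_def)
qed

lemma double_arc_move_end:
  assumes "double_arc C a b" "p \<in> C" "p \<noteq> a"
  shows "double_arc C a p"
proof (cases "p = b")
  case True
  then show ?thesis using assms by simp
next
  case False
  obtain A B where AB: "arc_between A a b" "arc_between B a b" "A \<inter> B = {a, b}" "C = A \<union> B" "p \<in> A"
    using assms(1,2) unfolding double_arc_def by (metis Int_commute Un_iff Un_commute)
  obtain A1 A2 where A12: "arc_between A1 a p" "arc_between A2 p b" "A = A1 \<union> A2" "A1 \<inter> A2 = {p}"
    using arc_between_split[OF AB(1,5) assms(3) False] .
  note ends = arc_between_ends[OF A12(1)] arc_between_ends[OF A12(2)] arc_between_ends[OF AB(1)]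
    arc_between_ends[OF AB(2)]
  have notin: "a \<notin> A2" "b \<notin> A1" using A12(4) ends(1,5) False assms(3) by (metis IntI singletonD)+
  have "B \<inter> A2 = {b}" using AB(3) A12(3) ends notin by auto
  then have "arc_between (B \<union> A2) a p"
    using AB(2) arc_between_sym[OF A12(2)] by (intro arc_between_join)
  moreover have "A1 \<inter> (B \<union> A2) = {a, p}" using AB(3) A12(3,4) ends notin by auto
  ultimately have "double_arc (A1 \<union> (B \<union> A2)) a p" using A12(1) by (intro double_arcI)
  then show ?thesis using AB A12 by (simp add: Un_ac)
qed

lemma double_arc_any_ends:
  assumes "double_arc C a b" "p \<in> C" "q \<in> C" "p \<noteq> q"
  shows "double_arc C p q"
proof (cases "p = a")
  case True
  then show ?thesis using double_arc_move_end[OF assms(1,3)] assms(4) by blast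
next
  case False
  have "double_arc C p a" by (rule double_arc_sym[OF double_arc_move_end[OF assms(1,2) False]])
  then show ?thesis by (rule double_arc_move_end) (use assms in auto)
qed

text \<open>
  With \<open>x\<close> as one of the marked points, what remains is two half-open arcs that share the other marked point.
\<close>

lemma double_arc_minus_point_connected:
  assumes C: "double_arc C a b"
  shows "connected (C - {x})"
proof -
  have con: "connected C"
  proof -
    obtain A B where "arc_between A a b" "arc_between B a b" "A \<inter> B = {a, b}" "C = A \<union> B"
      using C unfolding double_arc_def by blast
    then show ?thesis using arc_between_connected connected_Un by (metis insert_not_empty)
  qed
  show ?thesis
  proof (cases "x \<in> C")
    case False
    then show ?thesis using con by simp
  next
    case True
    obtain y where "y \<in> C" "x \<noteq> y" using double_arc_ends[OF C] by blast
    then have "double_arc C x y" using double_arc_any_ends[OF C True] by blast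
    then obtain A B where A: "arc_between A x y" and B: "arc_between B x y" and "C = A \<union> B"
      unfolding double_arc_def by blast
    then have "C - {x} = (A - {x}) \<union> (B - {x})" by blast
    moreover have "y \<in> (A - {x}) \<inter> (B - {x})"
      using arc_between_ends[OF A] arc_between_ends[OF B] by blast
    ultimately show ?thesis
      using arc_between_connected_minus_end A B by (metis connected_Un empty_iff)
  qed
qed

lemma circle_minus_point_connected:
  fixes C :: "'a::topological_space set"
  assumes "circle C"
  shows "connected (C - {x})"
proof -
  obtain f g where fg: "homeomorphism C (sphere (0::complex) 1) f g"
    using assms unfolding circle_def homeomorphic_def by blast
  have hom: "C homeomorphic sphere (0::complex) 1" using assms by (simp add: circle_def)
  show ?thesis
  proof (cases "x \<in> C")
    case False
    have "connected (sphere (0::complex) 1)" by (simp add: connected_sphere_eq)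
    then have "connected C" using hom homeomorphic_connectedness by blast
    then show ?thesis using False by simp
  next
    case True
    then have fx: "f x \<in> sphere 0 1" using fg by (auto simp: homeomorphism_def)
    let ?T = "{z::complex. 1 \<bullet> z = 0}"
    have "(sphere 0 1 - {f x}) homeomorphic ?T"
      using fx by (intro homeomorphic_punctured_sphere_hyperplane) auto
    moreover have "connected ?T" by (intro convex_connected convex_hyperplane)
    ultimately have "connected (sphere 0 1 - {f x})" using homeomorphic_connectedness by blast
    moreover have "continuous_on (sphere 0 1 - {f x}) g"
      using fg by (auto simp: homeomorphism_def intro: continuous_on_subset)
    ultimately have "connected (g ` (sphere 0 1 - {f x}))" by (rule connected_continuous_image[rotated])
    moreover have "g ` (sphere 0 1 - {f x}) = C - {x}"
    proof
      have g_eq: "f (g w) = w" "g w \<in> C" if "w \<in> sphere 0 1" for w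
        using fg that unfolding homeomorphism_def by blast+
      have f_eq: "g (f y) = y" "f y \<in> sphere 0 1" if "y \<in> C" for y
        using fg that unfolding homeomorphism_def by blast+
      show "g ` (sphere 0 1 - {f x}) \<subseteq> C - {x}"
      proof
        fix y assume "y \<in> g ` (sphere 0 1 - {f x})"
        then obtain w where "w \<in> sphere 0 1" "w \<noteq> f x" "y = g w" by (elim imageE DiffE) simp
        then show "y \<in> C - {x}" using g_eq[of w] by auto
      qed
      show "C - {x} \<subseteq> g ` (sphere 0 1 - {f x})"
      proof
        fix y assume y: "y \<in> C - {x}"
        then have "f y \<noteq> f x" using f_eq(1) True by (metis Diff_iff singletonI)
        then show "y \<in> g ` (sphere 0 1 - {f x})"
          using f_eq[of y] y by (intro image_eqI[of _ _ "f y"]) auto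
      qed
    qed
    ultimately show ?thesis by simp
  qed
qed

lemma theta_curve_iff:
  "theta_curve T \<longleftrightarrow>
     (\<exists>a b P Q R. arc_between P a b \<and> arc_between Q a b \<and> arc_between R a b \<and>
        P \<inter> Q = {a, b} \<and> P \<inter> R = {a, b} \<and> Q \<inter> R = {a, b} \<and> T = P \<union> Q \<union> R)"
proof
  assume "theta_curve T"
  then obtain a b p q r where
    arcs: "\<forall>g\<in>{p, q, r}. arc g \<and> pathstart g = a \<and> pathfinish g = b"
    and int: "path_image p \<inter> path_image q = {a, b}" "path_image p \<inter> path_image r = {a, b}"
      "path_image q \<inter> path_image r = {a, b}"
    and T: "T = path_image p \<union> path_image q \<union> path_image r"
    unfolding theta_curve_def by (elim exE conjE) (rule that)
  have "arc_between (path_image p) a b" "arc_between (path_image q) a b" "arc_between (path_image r) a b"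
    using arcs unfolding arc_between_def by auto
  then show "\<exists>a b P Q R. arc_between P a b \<and> arc_between Q a b \<and> arc_between R a b \<and>
      P \<inter> Q = {a, b} \<and> P \<inter> R = {a, b} \<and> Q \<inter> R = {a, b} \<and> T = P \<union> Q \<union> R"
    using int T by (intro exI conjI)
next
  assume "\<exists>a b P Q R. arc_between P a b \<and> arc_between Q a b \<and> arc_between R a b \<and>
      P \<inter> Q = {a, b} \<and> P \<inter> R = {a, b} \<and> Q \<inter> R = {a, b} \<and> T = P \<union> Q \<union> R"
  then obtain a b P Q R where PQR: "arc_between P a b" "arc_between Q a b" "arc_between R a b"
    and int: "P \<inter> Q = {a, b}" "P \<inter> R = {a, b}" "Q \<inter> R = {a, b}" "T = P \<union> Q \<union> R"
    by (elim exE conjE) (rule that)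
  obtain p where p: "arc p" "path_image p = P" "pathstart p = a" "pathfinish p = b"
    using PQR(1) unfolding arc_between_def by blast
  obtain q where q: "arc q" "path_image q = Q" "pathstart q = a" "pathfinish q = b"
    using PQR(2) unfolding arc_between_def by blast
  obtain r where r: "arc r" "path_image r = R" "pathstart r = a" "pathfinish r = b"
    using PQR(3) unfolding arc_between_def by blast
  show "theta_curve T"
    unfolding theta_curve_def using p q r int
    by (intro exI[of _ a] exI[of _ b] exI[of _ p] exI[of _ q] exI[of _ r]) simp
qed

text \<open>
  Any two points of a theta curve lie on one of its three circles, and each of these survives the removal
  of \<open>x\<close>.
\<close>

lemma theta_curve_minus_point_connected:
  assumes "theta_curve T"
  shows "connected (T - {x})"
proof -
  obtain a b P Q R where P: "arc_between P a b" and Q: "arc_between Q a b" and R: "arc_between R a b"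
    and int: "P \<inter> Q = {a, b}" "P \<inter> R = {a, b}" "Q \<inter> R = {a, b}" and T: "T = P \<union> Q \<union> R"
    using assms unfolding theta_curve_iff by blast
  have D: "connected (P \<union> Q - {x})" "connected (P \<union> R - {x})" "connected (Q \<union> R - {x})"
    using P Q R int double_arcI double_arc_minus_point_connected by metis+
  show ?thesis
    unfolding connected_iff_connected_component
  proof (intro ballI)
    fix y z assume y: "y \<in> T - {x}" and z: "z \<in> T - {x}"
    then have "\<exists>D\<in>{P \<union> Q - {x}, P \<union> R - {x}, Q \<union> R - {x}}. y \<in> D \<and> z \<in> D"
      using T by auto
    then obtain D where "connected D" "y \<in> D" "z \<in> D" "D \<subseteq> T - {x}"
      using D T by blast
    then show "connected_component (T - {x}) y z" unfolding connected_component_def by blast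
  qed
qed

definition ear :: "'a::t2_space set \<Rightarrow> 'a set \<Rightarrow> 'a \<Rightarrow> 'a \<Rightarrow> bool" where
  "ear C E a b \<longleftrightarrow> arc_between E a b \<and> E \<inter> C = {a, b}"

lemma ear_sym: "ear C E a b \<Longrightarrow> ear C E b a"
  unfolding ear_def using arc_between_sym by (metis insert_commute)

lemma circle_with_ear_is_theta_curve:
  assumes "double_arc C c d" "ear C E a b"
  shows "theta_curve (C \<union> E)"
proof -
  have "a \<in> C" "b \<in> C" "a \<noteq> b" using assms(2) arc_between_ends unfolding ear_def by blast+
  then obtain A B where "arc_between A a b" "arc_between B a b" "A \<inter> B = {a, b}" "C = A \<union> B"
    using double_arc_any_ends[OF assms(1)] unfolding double_arc_def by blast
  moreover from this have "A \<inter> E = {a, b}" "B \<inter> E = {a, b}"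
    using assms(2) arc_between_ends unfolding ear_def by blast+
  ultimately show ?thesis
    unfolding theta_curve_iff using assms(2) unfolding ear_def by blast
qed

text \<open>
  Keep the arc of the circle that contains \<open>x\<close> and replace the other one by the ear.
\<close>

lemma circle_through_ear:
  assumes "double_arc C c d" "ear C E a b" "x \<in> C"
  obtains D where "double_arc D a b" "x \<in> D" "E \<subseteq> D" "D \<subseteq> C \<union> E"
proof -
  have "a \<in> C" "b \<in> C" "a \<noteq> b" using assms(2) arc_between_ends unfolding ear_def by blast+
  then obtain A B where "arc_between A a b" "arc_between B a b" "A \<inter> B = {a, b}" "C = A \<union> B"
    using double_arc_any_ends[OF assms(1)] unfolding double_arc_def by blast
  then obtain A where A: "arc_between A a b" "A \<subseteq> C" "x \<in> A" using assms(3) by blast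
  then have "A \<inter> E = {a, b}" using assms(2) arc_between_ends unfolding ear_def by blast
  then have "double_arc (A \<union> E) a b" using A assms(2) double_arcI unfolding ear_def by blast
  then show ?thesis using that[of "A \<union> E"] A by blast
qed

text \<open>
  From the foot \<open>t\<close> of \<open>F\<close> inside \<open>E\<close> continue along \<open>E\<close> to an end of \<open>E\<close> different from the foot \<open>s\<close>
  of \<open>F\<close> on \<open>C\<close>.
\<close>

lemma ear_on_ear_one_foot:
  assumes E: "ear C E a b" and F: "ear (C \<union> E) F s t" and s: "s \<in> C" and t: "t \<notin> C"
  shows "\<exists>H c d. ear C H c d \<and> F \<subseteq> H \<and> H \<subseteq> E \<union> F"
proof -
  have arcs: "arc_between E a b" "arc_between F s t" and int: "E \<inter> C = {a, b}" "F \<inter> (C \<union> E) = {s, t}"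
    using E F by (auto simp: ear_def)
  have *: ?thesis if E': "arc_between E a' b'" "{a', b'} = {a, b}" "b' \<noteq> s" for a' b'
  proof -
    have "t \<in> E" using int t by blast
    moreover have "t \<noteq> a'" "t \<noteq> b'" using t int E'(2) by blast+
    ultimately obtain E1 E2 where E12: "arc_between E1 a' t" "arc_between E2 t b'" "E = E1 \<union> E2" "E1 \<inter> E2 = {t}"
      using arc_between_split[OF E'(1)] by blast
    note ends = arc_between_ends[OF E12(1)] arc_between_ends[OF E12(2)]
    have a': "a' \<notin> E2" using E12 ends by blast
    have "s \<notin> E2"
    proof
      assume "s \<in> E2"
      then have "s \<in> {a', b'}" using s int E12 E'(2) by blast
      then show False using \<open>s \<in> E2\<close> a' E'(3) by blast
    qed
    then have "F \<inter> E2 = {t}" using int(2) E12(3) ends(4) arc_between_ends(2)[OF arcs(2)] unfolding pointwise by metis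
    then have "arc_between (F \<union> E2) s b'" using arcs(2) E12(2) arc_between_join by blast
    moreover have "(F \<union> E2) \<inter> C = {s, b'}"
    proof -
      have "F \<inter> C = {s}" using int s t by blast
      moreover have "E2 \<inter> C = {b'}" using int(1) E12(3) E'(2) a' ends(5) unfolding pointwise by metis
      ultimately show ?thesis by blast
    qed
    ultimately have "ear C (F \<union> E2) s b'" by (simp add: ear_def)
    then show ?thesis using E12(3) by blast
  qed
  show ?thesis
  proof (cases "b = s")
    case False
    then show ?thesis using *[of a b] arcs by blast
  next
    case True
    then have "a \<noteq> s" using arc_between_ends[OF arcs(1)] by blast
    then show ?thesis using *[of b a] arc_between_sym[OF arcs(1)] by blast
  qed
qed

text \<open>
  Both feet of \<open>F\<close> are interior points of \<open>E\<close>: replace the part of \<open>E\<close> between them by \<open>F\<close>.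
\<close>

lemma ear_on_ear_no_foot:
  assumes E: "ear C E a b" and F: "ear (C \<union> E) F s t" and s: "s \<notin> C" and t: "t \<notin> C"
  shows "\<exists>H c d. ear C H c d \<and> F \<subseteq> H \<and> H \<subseteq> E \<union> F"
proof -
  have arcs: "arc_between E a b" "arc_between F s t" and int: "E \<inter> C = {a, b}" "F \<inter> (C \<union> E) = {s, t}"
    using E F by (auto simp: ear_def)
  have FC: "F \<inter> C = {}" using int(2) s t unfolding pointwise by metis
  have stE: "s \<in> E" "t \<in> E" using int(2) s t unfolding pointwise by metis+
  have *: ?thesis if E': "arc_between E1 a' s" "arc_between E2 s b'" "E = E1 \<union> E2" "E1 \<inter> E2 = {s}"
      "{a', b'} = {a, b}" "t \<in> E2" for a' b' E1 E2
  proof -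
    have "t \<noteq> s" "t \<noteq> b'" using t int E'(5) arc_between_ends[OF arcs(2)] by blast+
    then obtain E3 E4 where E34: "arc_between E3 s t" "arc_between E4 t b'" "E2 = E3 \<union> E4" "E3 \<inter> E4 = {t}"
      using arc_between_split[OF E'(2,6)] by blast
    note ends = arc_between_ends[OF E34(1)] arc_between_ends[OF E34(2)] arc_between_ends[OF E'(1)]
    have st: "t \<notin> E1" "s \<notin> E4" using E'(4,6) E34(4) ends(1,3) unfolding pointwise by metis+
    have "F \<inter> E1 = {s}" using int E' ends st stE by blast
    then have 1: "arc_between (E1 \<union> F) a' t"
      using E'(1) arcs(2) by (intro arc_between_join) auto
    have "F \<inter> E4 = {t}" using int(2) E'(3) E34(3) st(2) ends(4) arc_between_ends(2)[OF arcs(2)]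
      unfolding pointwise by metis
    moreover have "E1 \<inter> E4 = {}" using E'(4) E34(3) st(2) unfolding pointwise by metis
    ultimately have "(E1 \<union> F) \<inter> E4 = {t}" by blast
    then have "arc_between (E1 \<union> F \<union> E4) a' b'"
      by (rule arc_between_join[OF 1 E34(2)])
    moreover have "(E1 \<union> F \<union> E4) \<inter> C = {a', b'}"
      using FC int(1) E'(3,5) E34(3) ends(5,7) unfolding pointwise by metis
    ultimately have "ear C (E1 \<union> F \<union> E4) a' b'" by (simp add: ear_def)
    then show ?thesis using E' E34 by blast
  qed
  have "s \<noteq> a" "s \<noteq> b" using s int by blast+
  then obtain E1 E2 where E12: "arc_between E1 a s" "arc_between E2 s b" "E = E1 \<union> E2" "E1 \<inter> E2 = {s}"
    using arc_between_split[OF arcs(1) stE(1)] by blast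
  show ?thesis
  proof (cases "t \<in> E2")
    case True
    then show ?thesis using *[OF E12] by blast
  next
    case False
    then show ?thesis
      using *[OF arc_between_sym[OF E12(2)] arc_between_sym[OF E12(1)]] E12 stE by blast
  qed
qed

text \<open>
  The step that makes the union of all ears of \<open>C\<close> grow: a point on an ear of \<open>C \<union> E\<close> lies on an ear of
  \<open>C\<close> itself.
\<close>

lemma ear_on_ear:
  assumes E: "ear C E a b" and F: "ear (C \<union> E) F s t"
  shows "\<exists>H c d. ear C H c d \<and> F \<subseteq> H \<and> H \<subseteq> E \<union> F"
proof -
  consider "s \<in> C" "t \<in> C" | "s \<in> C" "t \<notin> C" | "s \<notin> C" "t \<in> C" | "s \<notin> C" "t \<notin> C" by blast
  then show ?thesis
  proof cases
    case 1
    then have "ear C F s t" using F unfolding ear_def by blast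
    then show ?thesis by blast
  next
    case 2
    then show ?thesis using ear_on_ear_one_foot[OF E F] by blast
  next
    case 3
    then show ?thesis using ear_on_ear_one_foot[OF E ear_sym[OF F]] by blast
  next
    case 4
    then show ?thesis using ear_on_ear_no_foot[OF E F] by blast
  qed
qed

section \<open>Finite graphs without cut points\<close>

locale graph_without_cut_points =
  fixes X :: "'a::t2_space set" and G :: "(real \<Rightarrow> 'a) set"
  assumes finite_edges: "finite G"
    and edge_arc: "g \<in> G \<Longrightarrow> arc g"
    and union_edges: "X = (\<Union>g\<in>G. path_image g)"
    and edges_meet: "\<lbrakk>g \<in> G; h \<in> G; g \<noteq> h\<rbrakk> \<Longrightarrow>
      path_image g \<inter> path_image h \<subseteq> {pathstart g, pathfinish g} \<inter> {pathstart h, pathfinish h}"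
    and connected: "connected X"
    and no_cut_points: "s \<in> X \<Longrightarrow> connected (X - {s})"
begin

lemma edge_subset: "g \<in> G \<Longrightarrow> path_image g \<subseteq> X"
  using union_edges by blast

lemma edge_closed: "g \<in> G \<Longrightarrow> closed (path_image g)"
  using edge_arc compact_arc_image compact_imp_closed by blast

lemma arc_avoiding_point:
  assumes "s \<in> X" "p \<in> X - {s}" "q \<in> X - {s}" "p \<noteq> q"
  obtains Q where "Q \<subseteq> X - {s}" "arc_between Q p q"
  using union_of_arcs_minus_point_arc_joined[OF finite_edges edge_arc union_edges no_cut_points, of s p q]
    assms unfolding arc_joined_def by blast

lemma free_arc_in_edge:
  assumes g: "g \<in> G" and uv: "0 \<le> u" "u < v" "v \<le> 1"
  shows "free_arc X (g ` {u..v}) (g u) (g v)"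
proof -
  define R where "R = (\<Union>h\<in>G-{g}. path_image h) \<union> g ` {0..u} \<union> g ` {v..1}"
  have cont: "continuous_on {0..1} g" and inj: "inj_on g {0..1}"
    using edge_arc[OF g] by (auto simp: arc_def path_def)
  have cl: "closed (g ` {x..y})" if "{x..y} \<subseteq> {0..1}" for x y
    using that cont by (meson compact_Icc compact_continuous_image compact_imp_closed continuous_on_subset)
  have "closed (\<Union>h\<in>G-{g}. path_image h)"
    using finite_edges edge_closed by (intro closed_UN) auto
  then have "closed R" unfolding R_def using uv by (intro closed_Un cl) auto
  moreover have "X = g ` {u..v} \<union> R"
  proof -
    have "{0..1} = {u..v} \<union> {0..u} \<union> {v..1}" using uv by auto
    then have "path_image g = g ` {u..v} \<union> g ` {0..u} \<union> g ` {v..1}"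
      by (metis image_Un path_image_def)
    moreover have "X = path_image g \<union> (\<Union>h\<in>G-{g}. path_image h)" using union_edges g by blast
    ultimately show ?thesis unfolding R_def by blast
  qed
  moreover have "g ` {u..v} \<inter> R \<subseteq> {g u, g v}"
  proof
    fix y assume y: "y \<in> g ` {u..v} \<inter> R"
    then obtain w where w: "w \<in> {u..v}" "y = g w" by blast
    have w01: "w \<in> {0..1}" using w uv by auto
    consider h where "h \<in> G" "h \<noteq> g" "y \<in> path_image h"
      | w' where "w' \<in> {0..u}" "y = g w'" | w' where "w' \<in> {v..1}" "y = g w'"
      using y unfolding R_def by blast
    then show "y \<in> {g u, g v}"
    proof cases
      case 1
      have "y \<in> path_image g" using w(2) w01 by (auto simp: path_image_def)
      then have "y \<in> {pathstart g, pathfinish g}"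
        using edges_meet[OF g 1(1) 1(2)[symmetric]] 1(3) by blast
      then have "g w = g 0 \<or> g w = g 1" using w by (auto simp: pathstart_def pathfinish_def)
      then have "w = 0 \<or> w = 1" using inj w01 by (auto dest: inj_onD)
      then have "w = u \<or> w = v" using w uv by auto
      then show ?thesis using w by blast
    next
      case 2
      then have "w = w'" using inj w w01 uv by (auto dest: inj_onD)
      then show ?thesis using 2 w by auto
    next
      case 3
      then have "w = w'" using inj w w01 uv by (auto dest: inj_onD)
      then show ?thesis using 3 w by auto
    qed
  qed
  ultimately show ?thesis
    unfolding free_arc_def using arc_between_restrict[OF edge_arc[OF g] uv] by blast
qed

text \<open>
  An arc from one end of the edge to the other that avoids the midpoint cannot enter either half of the
  edge, since each half is a free arc with the midpoint as one of its ends. So it closes the edge up to a circle.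
\<close>

lemma edge_on_circle:
  assumes g: "g \<in> G"
  obtains C where "C \<subseteq> X" "path_image g \<subseteq> C" "double_arc C (g 0) (g 1)"
proof -
  let ?A = "g ` {0..1}" and ?m = "g (1/2)"
  have inj: "inj_on g {0..1}" using edge_arc[OF g] by (simp add: arc_def)
  have A: "arc_between ?A (g 0) (g 1)" by (intro arc_between_restrict edge_arc g) auto
  have X: "?A \<subseteq> X" using edge_subset[OF g] by (simp add: path_image_def)
  have ne: "g 0 \<noteq> ?m" "g 1 \<noteq> ?m" "g 0 \<noteq> g 1"
    using inj by (auto dest: inj_onD)
  have m: "?m \<in> X" "g 0 \<in> X - {?m}" "g 1 \<in> X - {?m}" using X ne by auto
  obtain Q where Q: "Q \<subseteq> X - {?m}" "arc_between Q (g 0) (g 1)"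
    using arc_avoiding_point[OF m ne(3)] .
  have "Q \<inter> g ` {0..1/2} = {g 0}"
  proof (rule free_arc_escape[OF free_arc_in_edge[OF g] Q(2,1)])
    show "g 1 \<notin> g ` {0..1/2}"
    proof
      assume "g 1 \<in> g ` {0..1/2}"
      then obtain w where "w \<in> {0..1/2}" "g 1 = g w" by blast
      then show False using inj_onD[OF inj, of 1 w] by auto
    qed
  qed auto
  moreover have "Q \<inter> g ` {1/2..1} = {g 1}"
  proof (rule free_arc_escape[OF free_arc_sym[OF free_arc_in_edge[OF g]] arc_between_sym[OF Q(2)] Q(1)])
    show "g 0 \<notin> g ` {1/2..1}"
    proof
      assume "g 0 \<in> g ` {1/2..1}"
      then obtain w where "w \<in> {1/2..1}" "g 0 = g w" by blast
      then show False using inj_onD[OF inj, of 0 w] by auto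
    qed
  qed auto
  moreover have "?A = g ` {0..1/2} \<union> g ` {1/2..1}"
  proof -
    have "{0..1} = {0..1/2} \<union> {1/2..1::real}" by auto
    then show ?thesis by (metis image_Un)
  qed
  ultimately have "?A \<inter> Q = {g 0, g 1}" unfolding pointwise by metis
  then have "double_arc (?A \<union> Q) (g 0) (g 1)" using A Q by (intro double_arcI)
  then show ?thesis using that[of "?A \<union> Q"] X Q(1) by (auto simp: path_image_def)
qed

text \<open>
  The free arc sticks out of \<open>T\<close> at \<open>s\<close>. Since \<open>s\<close> is not a cut point, its outer end \<open>v\<close> can be joined to
  another point of \<open>T\<close> within \<open>X - {s}\<close>; stopped at the first point of \<open>T\<close>, this arc prolongs \<open>A\<close> to an ear.
\<close>

lemma ear_ending_in_free_arc:
  assumes A: "free_arc X A v s" and AT: "A \<inter> T = {s}"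
    and T: "closed T" "T \<subseteq> X" "t0 \<in> T" "t0 \<noteq> s"
  obtains F t where "F \<subseteq> X" "A \<subseteq> F" "ear T F s t"
proof -
  have arcA: "arc_between A v s" and AX: "A \<subseteq> X" using A by (auto simp: free_arc_def)
  note endsA = arc_between_ends[OF arcA]
  have vT: "v \<notin> T" using endsA AT by blast
  have "s \<in> X" "v \<in> X - {s}" "t0 \<in> X - {s}" "v \<noteq> t0" using endsA AX T AT vT by blast+
  then obtain Q where Q: "Q \<subseteq> X - {s}" "arc_between Q v t0" by (rule arc_avoiding_point)
  have "Q \<inter> T \<noteq> {}" using T arc_between_ends[OF Q(2)] by blast
  then obtain Q' t where Q': "Q' \<subseteq> Q" "arc_between Q' v t" "Q' \<inter> T = {t}"
    using first_hit[OF Q(2) T(1) vT] by blast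
  have "t \<notin> A" using Q' Q AT by blast
  then have "Q' \<inter> A = {v}" using free_arc_escape[OF A Q'(2)] Q' Q by blast
  then have "arc_between (A \<union> Q') s t"
    using arc_between_sym[OF arcA] Q'(2) by (intro arc_between_join) auto
  moreover have "(A \<union> Q') \<inter> T = {s, t}" using AT Q' by blast
  ultimately have "ear T (A \<union> Q') s t" by (simp add: ear_def)
  moreover have "A \<union> Q' \<subseteq> X" using AX Q'(1) Q(1) by blast
  ultimately show ?thesis using that[of "A \<union> Q'" t] by blast
qed

text \<open>
  From \<open>p\<close> walk along the edge in both directions until \<open>T\<close> is reached. If this happens on both sides, the
  piece of the edge between the two hits is an ear. If it happens on one side only, the piece from the hit
  to the far end of the edge sticks out of \<open>T\<close> and can be prolonged to an ear.
\<close>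

lemma ear_through_edge_point:
  assumes T: "closed T" "T \<subseteq> X" "t1 \<in> T" "t2 \<in> T" "t1 \<noteq> t2"
    and g: "g \<in> G" "path_image g \<inter> T \<noteq> {}" and p: "p \<in> path_image g" "p \<notin> T"
  obtains F s t where "F \<subseteq> X" "p \<in> F" "ear T F s t"
proof -
  have cont: "continuous_on {0..1} g" using edge_arc[OF g(1)] by (simp add: arc_def path_def)
  obtain c where c: "c \<in> {0..1}" "p = g c" using p by (auto simp: path_image_def)
  define J where "J = {0..1} \<inter> g -` T"
  have clJ: "closed J" unfolding J_def using cont T(1) by (intro continuous_closed_preimage) auto
  have cJ: "c \<notin> J" using c p by (auto simp: J_def)
  \<comment> \<open>Parameters of visits to \<open>T\<close> before and after \<open>p\<close>; the last one in \<open>L\<close> and the first one in \<open>R\<close> bound the piece around \<open>p\<close>.\<close>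
  define L where "L = J \<inter> {0..c}"
  define R where "R = J \<inter> {c..1}"
  have clL: "closed L" and clR: "closed R" using clJ by (auto simp: L_def R_def)
  have bL: "bdd_above L" and bR: "bdd_below R" by (auto simp: L_def R_def bdd_above_def bdd_below_def)
  have l: "Sup L \<in> J \<and> 0 \<le> Sup L \<and> Sup L < c \<and> {Sup L..c} \<inter> J = {Sup L}" if "L \<noteq> {}"
  proof -
    have 1: "Sup L \<in> L" using that clL bL by (intro closed_contains_Sup)
    have "w = Sup L" if "w \<in> {Sup L..c} \<inter> J" for w
    proof -
      have "w \<in> L" using that 1 by (auto simp: L_def)
      then have "w \<le> Sup L" using bL by (intro cSup_upper)
      then show ?thesis using that by auto
    qed
    then show ?thesis using 1 cJ by (auto simp: L_def less_le)
  qed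
  have r: "Inf R \<in> J \<and> Inf R \<le> 1 \<and> c < Inf R \<and> {c..Inf R} \<inter> J = {Inf R}" if "R \<noteq> {}"
  proof -
    have 1: "Inf R \<in> R" using that clR bR by (intro closed_contains_Inf)
    have "w = Inf R" if "w \<in> {c..Inf R} \<inter> J" for w
    proof -
      have "w \<in> R" using that 1 by (auto simp: R_def)
      then have "Inf R \<le> w" using bR by (intro cInf_lower)
      then show ?thesis using that by auto
    qed
    then show ?thesis using 1 cJ by (auto simp: R_def less_le)
  qed
  have trace: "g ` I \<inter> T = g ` (I \<inter> J)" if "I \<subseteq> {0..1}" for I
    using that by (auto simp: J_def)
  have t0: "\<exists>t0. t0 \<in> T \<and> t0 \<noteq> s" for s using T by blast
  have "J \<noteq> {}" using g(2) by (auto simp: J_def path_image_def)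
  moreover have "J = L \<union> R" by (auto simp: J_def L_def R_def)
  ultimately consider "L \<noteq> {}" "R \<noteq> {}" | "L \<noteq> {}" "R = {}" | "L = {}" "R \<noteq> {}" by blast
  then show ?thesis
  proof cases
    case 1
    let ?u = "Sup L" and ?v = "Inf R"
    note lr = l[OF 1(1)] r[OF 1(2)]
    have "{?u..?v} = {?u..c} \<union> {c..?v}" using lr by auto
    then have "{?u..?v} \<inter> J = {?u, ?v}" using lr by blast
    then have "g ` {?u..?v} \<inter> T = {g ?u, g ?v}" using trace[of "{?u..?v}"] lr by auto
    moreover have "arc_between (g ` {?u..?v}) (g ?u) (g ?v)"
      using lr by (intro arc_between_restrict edge_arc g) auto
    moreover have "g ` {?u..?v} \<subseteq> X" using edge_subset[OF g(1)] lr by (auto simp: path_image_def)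
    moreover have "p \<in> g ` {?u..?v}" using c lr by auto
    ultimately show ?thesis using that by (auto simp: ear_def)
  next
    case 2
    let ?u = "Sup L"
    note l' = l[OF 2(1)]
    then have uc: "?u < c" by blast
    have "{c..1} \<inter> J = {}" using 2(2) unfolding R_def by (simp add: Int_commute)
    moreover have "{?u..1} = {?u..c} \<union> {c..1}" using uc c by auto
    ultimately have "{?u..1} \<inter> J = {?u}" using l' by blast
    then have tr: "g ` {?u..1} \<inter> T = {g ?u}" using trace[of "{?u..1}"] l' by auto
    have "free_arc X (g ` {?u..1}) (g 1) (g ?u)"
      using l' c by (intro free_arc_sym[OF free_arc_in_edge[OF g(1)]]) auto
    then obtain F t where "F \<subseteq> X" "g ` {?u..1} \<subseteq> F" "ear T F (g ?u) t"
      using ear_ending_in_free_arc tr T t0 by metis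
    moreover have "p \<in> g ` {?u..1}" using c l' by auto
    ultimately show ?thesis using that by blast
  next
    case 3
    let ?v = "Inf R"
    note r' = r[OF 3(2)]
    then have cv: "c < ?v" by blast
    have "{0..c} \<inter> J = {}" using 3(1) unfolding L_def by (simp add: Int_commute)
    moreover have "{0..?v} = {0..c} \<union> {c..?v}" using cv c by auto
    ultimately have "{0..?v} \<inter> J = {?v}" using r' by blast
    then have tr: "g ` {0..?v} \<inter> T = {g ?v}" using trace[of "{0..?v}"] r' by auto
    have "free_arc X (g ` {0..?v}) (g 0) (g ?v)"
      using r' c by (intro free_arc_in_edge[OF g(1)]) auto
    then obtain F t where "F \<subseteq> X" "g ` {0..?v} \<subseteq> F" "ear T F (g ?v) t"
      using ear_ending_in_free_arc tr T t0 by metis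
    moreover have "p \<in> g ` {0..?v}" using c r' by auto
    ultimately show ?thesis using that by blast
  qed
qed

text \<open>
  An edge that meets \<open>C\<close> is covered by \<open>C\<close> and its ears by the previous lemma. An edge that only meets an ear
  \<open>E\<close> is covered by \<open>C \<union> E\<close> and ears of \<open>C \<union> E\<close>, and these extend to ears of \<open>C\<close>. So the set
  \<open>S\<close> of all covered points absorbs every edge that it meets.
\<close>

lemma ear_through_point:
  assumes C: "double_arc C c d" "C \<subseteq> X" and z: "z \<in> X" "z \<notin> C"
  obtains E a b where "E \<subseteq> X" "z \<in> E" "ear C E a b"
proof -
  define S where "S = C \<union> \<Union>{E. E \<subseteq> X \<and> (\<exists>a b. ear C E a b)}"
  have "S = X"
  proof (rule connected_absorbs_finite_closed_cover[OF connected])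
    show "finite (path_image ` G)" using finite_edges by blast
    show "closedin (top_of_set X) P" if "P \<in> path_image ` G" for P
      using that edge_closed edge_subset by (auto intro: closed_subset)
    show "X = \<Union>(path_image ` G)" by (rule union_edges)
    show "S \<subseteq> X" using C by (auto simp: S_def)
    show "S \<noteq> {}" using double_arc_ends[OF C(1)] by (auto simp: S_def)
    show "P \<subseteq> S" if P: "P \<in> path_image ` G" "P \<inter> S \<noteq> {}" for P
    proof
      fix p assume p: "p \<in> P"
      obtain g where g: "g \<in> G" "P = path_image g" using P by blast
      note Cends = double_arc_ends[OF C(1)] and Ccl = double_arc_closed[OF C(1)]
      show "p \<in> S"
      proof (cases "P \<inter> C = {}")
        case False
        show ?thesis
        proof (rule ccontr)
          assume pS: "p \<notin> S"
          then have "p \<notin> C" by (auto simp: S_def)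
          then obtain F s t where "F \<subseteq> X" "p \<in> F" "ear C F s t"
            using ear_through_edge_point[of C c d g p] Cends Ccl C(2) g p False by blast
          then show False using pS by (auto simp: S_def)
        qed
      next
        case True
        then obtain E a b where E: "E \<subseteq> X" "ear C E a b" "P \<inter> E \<noteq> {}"
          using P(2) by (auto simp: S_def)
        show ?thesis
        proof (rule ccontr)
          assume pS: "p \<notin> S"
          then have "p \<notin> C \<union> E" using E by (auto simp: S_def)
          moreover have "closed (C \<union> E)"
            using Ccl E(2) arc_between_closed unfolding ear_def by blast
          ultimately obtain F s t where F: "F \<subseteq> X" "p \<in> F" "ear (C \<union> E) F s t"
            using ear_through_edge_point[of "C \<union> E" c d g p] Cends C(2) E g p by blast
          obtain H c' d' where H: "ear C H c' d'" "F \<subseteq> H" "H \<subseteq> E \<union> F"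
            using ear_on_ear[OF E(2) F(3)] by blast
          have "H \<subseteq> X" using H(3) E(1) F(1) by blast
          then have "H \<subseteq> S" using H(1) unfolding S_def by blast
          then show False using pS F(2) H(2) by blast
        qed
      qed
    qed
  qed
  then show ?thesis using that z by (auto simp: S_def)
qed

lemma circle_through_two_points:
  assumes "x \<in> X" "y \<in> X" "x \<noteq> y"
  obtains C where "C \<subseteq> X" "double_arc C x y"
proof -
  obtain g where g: "g \<in> G" "x \<in> path_image g" using assms(1) union_edges by blast
  obtain C where C: "C \<subseteq> X" "path_image g \<subseteq> C" "double_arc C (g 0) (g 1)"
    using edge_on_circle[OF g(1)] .
  have x: "x \<in> C" using g C by blast
  show ?thesis
  proof (cases "y \<in> C")
    case True
    then show ?thesis using that C double_arc_any_ends x assms(3) by metis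
  next
    case False
    obtain E a b where E: "E \<subseteq> X" "y \<in> E" "ear C E a b"
      using ear_through_point[OF C(3,1) assms(2) False] .
    obtain D where D: "double_arc D a b" "x \<in> D" "E \<subseteq> D" "D \<subseteq> C \<union> E"
      using circle_through_ear[OF C(3) E(3) x] .
    have "double_arc D x y" using double_arc_any_ends[OF D(1,2)] D(3) E(2) assms(3) by blast
    then show ?thesis using that D C E by blast
  qed
qed

lemma circle_or_theta_curve_through_three_points:
  assumes "x \<in> X" "y \<in> X" "z \<in> X" "x \<noteq> y"
  shows "(\<exists>C\<subseteq>X. circle C \<and> {x, y, z} \<subseteq> C) \<or> (\<exists>T\<subseteq>X. theta_curve T \<and> {x, y, z} \<subseteq> T)"
proof -
  obtain C where C: "C \<subseteq> X" "double_arc C x y" using circle_through_two_points assms by blast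
  note xy = double_arc_ends[OF C(2)]
  show ?thesis
  proof (cases "z \<in> C")
    case True
    have "circle C" using C(2) by (rule double_arc_imp_circle)
    moreover have "{x, y, z} \<subseteq> C" using xy True by simp
    ultimately show ?thesis using C(1) by blast
  next
    case False
    then obtain E a b where E: "E \<subseteq> X" "z \<in> E" "ear C E a b"
      using ear_through_point[OF C(2,1) assms(3)] by blast
    have "theta_curve (C \<union> E)" using circle_with_ear_is_theta_curve[OF C(2) E(3)] .
    moreover have "{x, y, z} \<subseteq> C \<union> E" "C \<union> E \<subseteq> X" using xy C(1) E(1,2) by simp_all
    ultimately show ?thesis by blast
  qed
qed

text \<open>
  The circle through \<open>x\<close> and \<open>y\<close> offers two ways from \<open>x\<close> to \<open>y\<close>. If \<open>z\<close> or a foot \<open>w\<close> of an ear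
  through \<open>z\<close> lies strictly inside one of them, take the other one from \<open>x\<close> to \<open>y\<close>, continue to \<open>w\<close> and leave the circle
  there. Otherwise the feet of the ear are \<open>x\<close> and \<open>y\<close>, and the leg of the ear at \<open>y\<close> leads to \<open>z\<close>
  directly.
\<close>

lemma arc_with_middle_point:
  assumes "x \<in> X" "y \<in> X" "z \<in> X" "x \<noteq> y" "y \<noteq> z" "x \<noteq> z"
  obtains P Q where "arc_between P x y" "arc_between Q y z" "P \<inter> Q = {y}" "P \<union> Q \<subseteq> X"
proof -
  obtain C where C: "C \<subseteq> X" "double_arc C y x" using circle_through_two_points assms by metis
  note goal = that
  \<comment> \<open>\<open>Z\<close> is the leg from \<open>w\<close> to \<open>z\<close>; the case \<open>Z = {}\<close> stands for \<open>z\<close> being on the circle.\<close>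
  have split: thesis
    if w: "w \<in> C" "w \<noteq> x" "w \<noteq> y"
      and Z: "Z = {} \<and> w = z \<or> arc_between Z w z" "Z \<inter> C \<subseteq> {w}" "Z \<subseteq> X" for w Z
  proof -
    obtain A B where AB: "arc_between A y x" "arc_between B y x" "A \<inter> B = {y, x}" "C = A \<union> B" "w \<in> A"
      using C(2) w(1) unfolding double_arc_def by (metis Int_commute Un_iff Un_commute)
    obtain A1 A2 where A12: "arc_between A1 y w" "arc_between A2 w x" "A = A1 \<union> A2" "A1 \<inter> A2 = {w}"
      using arc_between_split[OF AB(1,5) w(3,2)] .
    note ends = arc_between_ends[OF A12(1)] arc_between_ends[OF A12(2)] arc_between_ends[OF AB(2)]
    have x: "x \<notin> A1" using A12(4) ends(5) w(2) unfolding pointwise by metis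
    have "arc_between (A1 \<union> Z) y z"
    proof (cases "Z = {}")
      case True
      then have "w = z" using Z(1) arc_between_ends(1) by blast
      then show ?thesis using True A12(1) by simp
    next
      case False
      then have Z': "arc_between Z w z" using Z(1) by blast
      have "A1 \<inter> Z = {w}" using Z(2) AB A12 ends arc_between_ends[OF Z'] by blast
      then show ?thesis using A12(1) Z' by (intro arc_between_join)
    qed
    moreover have "B \<inter> (A1 \<union> Z) = {y}"
    proof -
      have "w \<notin> B" using AB(3,5) w(2,3) unfolding pointwise by metis
      then have "B \<inter> Z = {}" using Z(2) AB(4) by blast
      moreover have "B \<inter> A1 = {y}"
        using AB(3) A12(3) x ends(1) unfolding pointwise by metis
      ultimately show ?thesis by blast
    qed
    moreover have "B \<union> (A1 \<union> Z) \<subseteq> X" using AB A12 C Z by blast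
    ultimately show thesis using goal[of B "A1 \<union> Z"] arc_between_sym[OF AB(2)] by blast
  qed
  show thesis
  proof (cases "z \<in> C")
    case True
    then show thesis using split[of z "{}"] assms by blast
  next
    case False
    then obtain E a b where E: "E \<subseteq> X" "z \<in> E" "ear C E a b"
      using ear_through_point[OF C(2,1) assms(3)] by blast
    have Eab: "arc_between E a b" "E \<inter> C = {a, b}" using E(3) by (auto simp: ear_def)
    have "z \<noteq> a" "z \<noteq> b" using False Eab by blast+
    then obtain E1 E2 where E12: "arc_between E1 a z" "arc_between E2 z b" "E = E1 \<union> E2" "E1 \<inter> E2 = {z}"
      using arc_between_split[OF Eab(1) E(2)] by blast
    have legs: "\<exists>Z. arc_between Z w z \<and> Z \<inter> C = {w} \<and> Z \<subseteq> X" if "w \<in> {a, b}" for w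
    proof -
      note ends = arc_between_ends[OF E12(1)] arc_between_ends[OF E12(2)]
      have "E1 \<inter> C = {a}" "E2 \<inter> C = {b}" using Eab(2) E12(3,4) ends unfolding pointwise by metis+
      then show ?thesis using that E12 E arc_between_sym[OF E12(2)] by blast
    qed
    show thesis
    proof (cases "{a, b} \<subseteq> {x, y}")
      case False
      then obtain w where w: "w \<in> {a, b}" "w \<noteq> x" "w \<noteq> y" by blast
      obtain Z where "arc_between Z w z" "Z \<inter> C = {w}" "Z \<subseteq> X" using legs[OF w(1)] by blast
      then show thesis using split[of w Z] w Eab by blast
    next
      case True
      then have "y \<in> {a, b}" using arc_between_ends(3)[OF Eab(1)] by blast
      then obtain Z where Z: "arc_between Z y z" "Z \<inter> C = {y}" "Z \<subseteq> X" using legs by blast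
      obtain A where A: "arc_between A y x" "A \<subseteq> C" using C(2) unfolding double_arc_def by blast
      have "A \<inter> Z = {y}" using A Z arc_between_ends[OF A(1)] by blast
      then show thesis using that[of A Z] arc_between_sym[OF A(1)] Z A C by blast
    qed
  qed
qed

end

section \<open>The three conditions\<close>

lemma strongly_arc_connected_3I:
  fixes X :: "'a::t2_space set"
  assumes "\<And>x y z. \<lbrakk>x \<in> X; y \<in> X; z \<in> X; x \<noteq> y; y \<noteq> z; x \<noteq> z\<rbrakk> \<Longrightarrow>
    \<exists>P Q. arc_between P x y \<and> arc_between Q y z \<and> P \<inter> Q = {y} \<and> P \<union> Q \<subseteq> X"
  shows "strongly_arc_connected 3 X"
  unfolding strongly_arc_connected_def
proof (intro allI impI)
  have I: "{1..3::nat} = {1, 2, 3}" by auto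
  fix x :: "nat \<Rightarrow> 'a"
  assume x: "inj_on x {1..3} \<and> x ` {1..3} \<subseteq> X"
  then have "x 1 \<in> X" "x 2 \<in> X" "x 3 \<in> X" "x 1 \<noteq> x 2" "x 2 \<noteq> x 3" "x 1 \<noteq> x 3"
    unfolding I by (auto simp: inj_on_def)
  then obtain P Q where PQ: "arc_between P (x 1) (x 2)" "arc_between Q (x 2) (x 3)" "P \<inter> Q = {x 2}"
    "P \<union> Q \<subseteq> X"
    using assms by blast
  obtain g h where g: "arc g" "path_image g = P" "pathstart g = x 1" "pathfinish g = x 2"
    and h: "arc h" "path_image h = Q" "pathstart h = x 2" "pathfinish h = x 3"
    using PQ unfolding arc_between_def by blast
  define \<alpha> where "\<alpha> = g +++ h"
  \<comment> \<open>In the joined path the marked points are visited at the times 0, 1/2 and 1.\<close>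
  define t :: "nat \<Rightarrow> real" where "t = (\<lambda>i. (real i - 1) / 2)"
  have "arc \<alpha>" unfolding \<alpha>_def using g h PQ by (intro arc_join) auto
  moreover have "path_image \<alpha> \<subseteq> X" unfolding \<alpha>_def using g h PQ by (simp add: path_image_join)
  moreover have "t ` {1..3} \<subseteq> {0..1}" "strict_mono_on {1..3} t"
    by (auto simp: t_def strict_mono_on_def)
  moreover have "\<forall>i\<in>{1..3}. \<alpha> (t i) = x i"
    unfolding I using g h by (auto simp: \<alpha>_def t_def joinpaths_def pathstart_def pathfinish_def)
  ultimately show "\<exists>\<alpha> t. arc \<alpha> \<and> path_image \<alpha> \<subseteq> X \<and> t ` {1..3} \<subseteq> {0..1} \<and>
      strict_mono_on {1..3} t \<and> (\<forall>i\<in>{1..3}. \<alpha> (t i) = x i)"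
    by blast
qed

lemma not_cut_point_if_joined:
  assumes "\<And>y z. \<lbrakk>y \<in> X; z \<in> X; y \<noteq> x; z \<noteq> x; y \<noteq> z\<rbrakk> \<Longrightarrow> \<exists>K\<subseteq>X - {x}. connected K \<and> y \<in> K \<and> z \<in> K"
  shows "\<not> cut_point X x"
proof -
  have "connected_component (X - {x}) y z" if "y \<in> X - {x}" "z \<in> X - {x}" for y z
  proof (cases "y = z")
    case True
    then show ?thesis using that by simp
  next
    case False
    then show ?thesis using assms[of y z] that unfolding connected_component_def by blast
  qed
  then show ?thesis by (simp add: cut_point_def connected_iff_connected_component)
qed

lemma strongly_arc_connected_3_no_cut_point:
  fixes X :: "'a::t2_space set"
  assumes "strongly_arc_connected 3 X" "x \<in> X"
  shows "\<not> cut_point X x"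
proof (rule not_cut_point_if_joined)
  have I: "{1..3::nat} = {1, 2, 3}" by auto
  fix y z assume yz: "y \<in> X" "z \<in> X" "y \<noteq> x" "z \<noteq> x" "y \<noteq> z"
  define f :: "nat \<Rightarrow> 'a" where "f = (\<lambda>i. if i = 1 then x else if i = 2 then y else z)"
  have "inj_on f {1..3}" "f ` {1..3} \<subseteq> X"
    unfolding I using yz assms(2) by (auto simp: f_def)
  then have "\<exists>\<alpha> t. arc \<alpha> \<and> path_image \<alpha> \<subseteq> X \<and> t ` {1..3} \<subseteq> {0..1} \<and>
      strict_mono_on {1..3} t \<and> (\<forall>i\<in>{1..3}. \<alpha> (t i) = f i)"
    by (intro spec[OF assms(1)[unfolded strongly_arc_connected_def], THEN mp] conjI)
  then obtain \<alpha> t where \<alpha>: "arc \<alpha>" "path_image \<alpha> \<subseteq> X" "t ` {1..3} \<subseteq> {0..1}"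
      "strict_mono_on {1..3} t" "\<forall>i\<in>{1..3}. \<alpha> (t i) = f i"
    by (elim exE conjE) (rule that)
  have t: "t 1 < t 2" "t 2 < t 3" using \<alpha>(4) by (auto simp: strict_mono_on_def)
  have t01: "0 \<le> t 1" "t 3 \<le> 1" using \<alpha>(3) by (auto simp: image_subset_iff)
  have v: "\<alpha> (t 1) = x" "\<alpha> (t 2) = y" "\<alpha> (t 3) = z" using \<alpha>(5) by (auto simp: f_def)
  let ?K = "\<alpha> ` {t 2..t 3}"
  have K: "arc_between ?K y z" using arc_between_restrict[OF \<alpha>(1), of "t 2" "t 3"] t t01 v by simp
  have "x \<notin> ?K"
  proof
    assume "x \<in> ?K"
    then obtain w where w: "w \<in> {t 2..t 3}" "\<alpha> w = \<alpha> (t 1)" using v by auto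
    then have "w = t 1" using \<alpha>(1) t t01 by (auto simp: arc_def dest!: inj_onD)
    then show False using w t by auto
  qed
  moreover have "?K \<subseteq> X" using \<alpha>(2) t t01 by (auto simp: path_image_def)
  ultimately show "\<exists>K\<subseteq>X - {x}. connected K \<and> y \<in> K \<and> z \<in> K"
    using arc_between_connected[OF K] arc_between_ends[OF K] by blast
qed

theorem corollary7:
  fixes X :: "'a::metric_space set"
  assumes "finite_graph X"
  shows "(\<not> (\<exists>x. cut_point X x) \<longleftrightarrow> strongly_arc_connected 3 X) \<and>
    (strongly_arc_connected 3 X \<longleftrightarrow>
      (\<forall>x\<in>X. \<forall>y\<in>X. \<forall>z\<in>X. x \<noteq> y \<and> y \<noteq> z \<and> x \<noteq> z \<longrightarrow>
        (\<exists>C\<subseteq>X. circle C \<and> {x, y, z} \<subseteq> C) \<or>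
        (\<exists>T\<subseteq>X. theta_curve T \<and> {x, y, z} \<subseteq> T)))"
    (is "(?cut \<longleftrightarrow> ?sac) \<and> (?sac \<longleftrightarrow> ?theta)")
proof -
  obtain G :: "(real \<Rightarrow> 'a) set" where con: "connected X"
    and G: "finite G" "\<forall>g\<in>G. arc g" "X = (\<Union>g\<in>G. path_image g)"
      "\<forall>g\<in>G. \<forall>h\<in>G. g \<noteq> h \<longrightarrow>
           path_image g \<inter> path_image h
             \<subseteq> {pathstart g, pathfinish g} \<inter> {pathstart h, pathfinish h}"
    using assms unfolding finite_graph_def nondegenerate_continuum_def by blast
  have graph: "graph_without_cut_points X G" if "?cut"
  proof
    show "connected (X - {s})" if "s \<in> X" for s using \<open>?cut\<close> that by (auto simp: cut_point_def)
  qed (use G con in blast)+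
  have 1: ?sac if "?cut"
    using graph_without_cut_points.arc_with_middle_point[OF graph[OF that]]
    by (intro strongly_arc_connected_3I) metis
  have 2: ?cut if "?sac"
    using strongly_arc_connected_3_no_cut_point[OF that] by (auto simp: cut_point_def)
  have 3: ?theta if "?cut"
    using graph_without_cut_points.circle_or_theta_curve_through_three_points[OF graph[OF that]] by blast
  have 4: ?cut if theta: "?theta"
  proof
    assume "\<exists>x. cut_point X x"
    then obtain x where x: "cut_point X x" by blast
    then have xX: "x \<in> X" by (simp add: cut_point_def)
    have "\<not> cut_point X x"
    proof (rule not_cut_point_if_joined)
      fix y z assume yz: "y \<in> X" "z \<in> X" "y \<noteq> x" "z \<noteq> x" "y \<noteq> z"
      then obtain K where "K \<subseteq> X" "{x, y, z} \<subseteq> K" "circle K \<or> theta_curve K"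
        using theta xX by metis
      from this(3) have "connected (K - {x})"
        by (metis circle_minus_point_connected theta_curve_minus_point_connected)
      moreover have "K - {x} \<subseteq> X - {x}" "y \<in> K - {x}" "z \<in> K - {x}"
        using \<open>K \<subseteq> X\<close> \<open>{x, y, z} \<subseteq> K\<close> yz(3,4) by auto
      ultimately show "\<exists>K\<subseteq>X - {x}. connected K \<and> y \<in> K \<and> z \<in> K" by blast
    qed
    then show False using x by blast
  qed
  show ?thesis using 1 2 3 4 by blast
qed

end
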